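(* Let $k\geq 2$ be an integer, let $\phi\in(0,\frac{\pi}{2})$ and $\rho\in[0,2\pi)$, and let $\gamma\colon[0,1]\to\mathbb{R}^2$ be a continuous curve. Suppose that for every point $P\in\mathbb{R}^2$, every line contained in the cone $C_P(\phi,\rho)$ intersects (the image of) $\gamma$ in at most $k$ points. Then the image of $\gamma$ can be written as a union of countably many sets $\gamma_n$, each with $\mathcal{H}^1(\gamma_n)<\infty$. In particular, $\gamma$ is $1$-rectifiable.
   Context: $\mathcal{H}^1$ is the one-dimensional Hausdorff measure on $\mathbb{R}^2$. The curve $\gamma$ is identified with its image $\gamma([0,1])$. For $0<\phi<\frac{\pi}{2}$, $C(\phi,0)=\{(x,y)\in\mathbb{R}^2 : |y|\geq\tan(\phi)\,|x|\}$ is the closed vertical double cone with vertex $0$; $C(\phi,\rho)$ is its counter-clockwise rotation about $0$ by the angle $\rho$; and $C_P(\phi,\rho)=P+C(\phi,\rho)$ is the translate with vertex $P$. A set $E\subset\mathbb{R}^2$ is $1$-rectifiable if there are countably many Lipschitz maps $g_i\colon\mathbb{R}\to\mathbb{R}^2$ with $\mathcal{H}^1\big(E\setminus\bigcup_i g_i(\mathbb{R})\big)=0$. *)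

theory Defs
  imports "HOL-Analysis.Analysis"
begin

text \<open>
  One-dimensional Hausdorff (outer) measure by covers of small diameter. In dimension one the usual
  normalising constant is 1. Cover elements are required to be bounded because \<^const>\<open>diameter\<close> is
  only meaningful on bounded sets. If no admissible cover exists, the infimum is \<open>\<infinity>\<close>.
\<close>

definition hausdorff1_pre :: "real \<Rightarrow> 'a::metric_space set \<Rightarrow> ennreal" where
  "hausdorff1_pre \<delta> A =
     (INF U \<in> {U :: nat \<Rightarrow> 'a set. A \<subseteq> (\<Union>i. U i) \<and> (\<forall>i. bounded (U i) \<and> diameter (U i) \<le> \<delta>)}.
        \<Sum>i. ennreal (diameter (U i)))"

definition hausdorff1 :: "'a::metric_space set \<Rightarrow> ennreal" where
  "hausdorff1 A = (SUP \<delta> \<in> {0<..}. hausdorff1_pre \<delta> A)"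

definition rectifiable1 :: "(real^2) set \<Rightarrow> bool" where
  "rectifiable1 E \<longleftrightarrow>
     (\<exists>g :: nat \<Rightarrow> real \<Rightarrow> real^2.
        (\<forall>i. \<exists>L. L-lipschitz_on UNIV (g i)) \<and> hausdorff1 (E - (\<Union>i. range (g i))) = 0)"

text \<open>Counter-clockwise rotation about the origin.\<close>

definition rotate2 :: "real \<Rightarrow> real^2 \<Rightarrow> real^2" where
  "rotate2 \<rho> v = vector [cos \<rho> * v$1 - sin \<rho> * v$2, sin \<rho> * v$1 + cos \<rho> * v$2]"

definition cone0 :: "real \<Rightarrow> (real^2) set" where
  "cone0 \<phi> = {v. \<bar>v$2\<bar> \<ge> tan \<phi> * \<bar>v$1\<bar>}"

definition cone_at :: "real^2 \<Rightarrow> real \<Rightarrow> real \<Rightarrow> (real^2) set" where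
  "cone_at P \<phi> \<rho> = (+) P ` rotate2 \<rho> ` cone0 \<phi>"

definition is_line :: "'a::euclidean_space set \<Rightarrow> bool" where
  "is_line l \<longleftrightarrow> affine l \<and> aff_dim l = 1"

end

theory Submission
  imports Defs
begin

text \<open>
  The curve is covered by countably many bounded pieces of Lipschitz graphs. This gives both
  conclusions at once: each piece has finite length, and nothing of the image is left outside the
  Lipschitz curves that carry the pieces.

  Choose \<open>2 * k + 2\<close> directions in the cone. Consecutive ones bound \<open>2 * k + 1\<close> disjoint open double
  sectors. The heart of the proof (\<open>empty_sector_at_point\<close>) is that at every point \<open>p\<close> of the curve at
  least one of these sectors, placed at \<open>p\<close>, contains no point of the curve near \<open>p\<close>. Suppose that the
  curve accumulates at \<open>p\<close> inside every sector. A curve point \<open>q\<close> close to \<open>p\<close> is joined to \<open>p\<close> by a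
  short piece of the curve; cut at its last visit to \<open>p\<close>, this piece can meet the chosen lines
  through \<open>p\<close> only at points different from \<open>p\<close>. There are finitely many such points, so a short
  piece misses them all and stays inside the sector of \<open>q\<close> (\<open>path_image_branch_off_lines\<close>). The
  curve therefore contains pieces issuing from \<open>p\<close> in each of the \<open>2 * k + 1\<close> sectors, and at least
  \<open>k + 1\<close> of them lie on the same side of the line through \<open>p\<close> in the first direction. A small parallel
  shift of that line to this side crosses these \<open>k + 1\<close> disjoint pieces, although its direction is in
  the cone.

  The points that share the sector and the size of the empty neighbourhood, restricted to a small
  ball, form a set whose differences all avoid one fixed double sector. The component of a difference
  across the middle line of that sector then controls the difference (\<open>norm_le_off_sector\<close>), so the
  set is a Lipschitz graph over the perpendicular of that line.
\<close>

section \<open>Pieces of a curve issuing from a point\<close>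

text \<open>The piece of the path after its last visit to \<open>p\<close>.\<close>

lemma path_tail_off_point:
  fixes g :: "real \<Rightarrow> 'a::metric_space"
  assumes g: "path g" and start: "pathstart g = p" and finish: "pathfinish g \<noteq> p"
  obtains C where "connected C" "pathfinish g \<in> C" "C \<subseteq> path_image g" "p \<notin> C" "p \<in> closure C"
proof -
  define B where "B = {x \<in> {0..1}. g x = p}"
  have cont: "continuous_on {0..1} g"
    using g by (simp add: path_def)
  have "closed B"
    unfolding B_def by (rule continuous_closed_preimage_constant[OF cont]) auto
  moreover have B01: "B \<subseteq> {0..1}" and "0 \<in> B"
    using start by (auto simp: B_def pathstart_def)
  ultimately have "compact B" "B \<noteq> {}"
    using bounded_subset[OF bounded_closed_interval B01] by (auto simp: compact_eq_bounded_closed)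
  then obtain l where l: "l \<in> B" and last: "\<And>x. x \<in> B \<Longrightarrow> x \<le> l"
    using compact_attains_sup by metis
  have gl: "g l = p" and l0: "0 \<le> l" and "l \<le> 1" "l \<noteq> 1"
    using l finish by (auto simp: B_def pathfinish_def)
  then have l1: "l < 1" by simp
  have sub: "{l<..1} \<subseteq> {0..1}" using l0 by auto
  show thesis
  proof (rule that[of "g ` {l<..1}"])
    show "connected (g ` {l<..1})"
      by (intro connected_continuous_image continuous_on_subset[OF cont sub]) auto
    show "pathfinish g \<in> g ` {l<..1}"
      using l1 by (auto simp: pathfinish_def)
    show "g ` {l<..1} \<subseteq> path_image g"
      using sub by (auto simp: path_image_def)
    show "p \<notin> g ` {l<..1}"
    proof
      assume "p \<in> g ` {l<..1}"
      then obtain x where "l < x" "x \<le> 1" "g x = p"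
        by auto
      then show False
        using last[of x] l0 by (simp add: B_def)
    qed
    have "g ` closure {l<..1} \<subseteq> closure (g ` {l<..1})"
      using l0 l1 closure_subset[of "g ` {l<..1}"]
      by (intro image_closure_subset) (simp_all add: continuous_on_subset[OF cont])
    moreover have "l \<in> closure {l<..1}"
      using l1 by simp
    ultimately show "p \<in> closure (g ` {l<..1})"
      using gl by blast
  qed
qed

text \<open>
  The path may visit \<open>p\<close> infinitely often, so being close to \<open>p\<close> in space has to be turned into being
  close in time to some visit. Compactness does this: the parameters at distance at least \<open>d\<close> from all
  visits are mapped to a compact set off \<open>p\<close>.
\<close>

lemma path_image_branch_off_lines:
  fixes \<gamma> :: "real \<Rightarrow> 'a::euclidean_space" and F :: "'a set"
  assumes \<gamma>: "path \<gamma>" and p: "p \<in> path_image \<gamma>"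
    and "finite F" and "F \<noteq> {}"
    and lines: "\<And>n. n \<in> F \<Longrightarrow> finite {q \<in> path_image \<gamma>. n \<bullet> (q - p) = 0}"
  obtains r where "r > 0"
    "\<And>q. q \<in> path_image \<gamma> \<Longrightarrow> dist q p < r \<Longrightarrow> q \<noteq> p \<Longrightarrow>
       \<exists>C. connected C \<and> q \<in> C \<and> C \<subseteq> path_image \<gamma> \<and> p \<in> closure C \<and>
           (\<forall>n\<in>F. \<forall>c\<in>C. n \<bullet> (c - p) \<noteq> 0)"
proof -
  have cont: "continuous_on {0..1} \<gamma>"
    using \<gamma> by (simp add: path_def)
  have "finite (\<Union>n\<in>F. {q \<in> path_image \<gamma>. n \<bullet> (q - p) = 0})"
    using \<open>finite F\<close> lines by blast
  from finite_set_avoid[OF this, of p] obtain e where "e > 0"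
    and e: "\<And>n q. n \<in> F \<Longrightarrow> q \<in> path_image \<gamma> \<Longrightarrow> n \<bullet> (q - p) = 0 \<Longrightarrow> q \<noteq> p \<Longrightarrow> e \<le> dist p q"
    by blast
  have "uniformly_continuous_on {0..1} \<gamma>"
    by (rule compact_uniformly_continuous[OF cont]) simp
  then obtain d where "d > 0"
    and d: "\<And>s t. s \<in> {0..1} \<Longrightarrow> t \<in> {0..1} \<Longrightarrow> dist t s < d \<Longrightarrow> dist (\<gamma> t) (\<gamma> s) < e"
    using \<open>e > 0\<close> unfolding uniformly_continuous_on_def by metis
  \<comment> \<open>\<open>T\<close> consists of the parameters at distance at least \<open>d\<close> from every visit to \<open>p\<close>.\<close>
  define T where "T = {0..1} - (\<Union>s\<in>{s\<in>{0..1}. \<gamma> s = p}. ball s d)"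
  have "compact T"
    unfolding T_def by (intro compact_diff) auto
  then have "closed (\<gamma> ` T)"
    by (intro compact_imp_closed compact_continuous_image continuous_on_subset[OF cont]) (auto simp: T_def)
  moreover have "p \<notin> \<gamma> ` T"
    using \<open>d > 0\<close> by (auto simp: T_def)
  ultimately obtain r where "r > 0" and r: "\<And>x. x \<in> \<gamma> ` T \<Longrightarrow> r \<le> dist p x"
    using separate_point_closed by metis
  show thesis
  proof (rule that[OF \<open>r > 0\<close>])
    fix q assume "q \<in> path_image \<gamma>" "dist q p < r" "q \<noteq> p"
    then obtain t where t: "t \<in> {0..1}" "\<gamma> t = q"
      by (auto simp: path_image_def)
    have "t \<notin> T"
      using r[of q] t \<open>dist q p < r\<close> by (auto simp: dist_commute)
    then obtain s where s: "s \<in> {0..1}" "\<gamma> s = p" "dist s t < d"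
      using t by (auto simp: T_def)
    define g where "g = subpath s t \<gamma>"
    have "path g" "pathstart g = p" "pathfinish g = q"
      using \<gamma> s t by (simp_all add: g_def)
    then obtain C where C: "connected C" "q \<in> C" "C \<subseteq> path_image g" "p \<notin> C" "p \<in> closure C"
      using path_tail_off_point[of g p] \<open>q \<noteq> p\<close> by metis
    have img: "path_image g \<subseteq> path_image \<gamma>"
      unfolding g_def using s t by (intro path_image_subpath_subset) auto
    have near: "dist p c < e" if "c \<in> path_image g" for c
    proof -
      from that obtain u where u: "u \<in> closed_segment s t" "c = \<gamma> u"
        unfolding g_def path_image_subpath_gen by blast
      then have "u \<in> {0..1}" "dist u s < d"
        using s t by (auto simp: closed_segment_eq_real_ivl dist_real_def split: if_splits)
      then show ?thesis
        using d[of s u] s u by (simp add: dist_commute)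
    qed
    have "n \<bullet> (c - p) \<noteq> 0" if "n \<in> F" "c \<in> C" for n c
      using e[of n c] near[of c] that C img by force
    then show "\<exists>C. connected C \<and> q \<in> C \<and> C \<subseteq> path_image \<gamma> \<and> p \<in> closure C \<and>
           (\<forall>n\<in>F. \<forall>c\<in>C. n \<bullet> (c - p) \<noteq> 0)"
      using C img by blast
  qed
qed

lemma connected_inner_same_sign:
  fixes C :: "'a::real_inner set"
  assumes "connected C" "x \<in> C" "y \<in> C" and nz: "\<And>c. c \<in> C \<Longrightarrow> n \<bullet> (c - p) \<noteq> 0"
  shows "0 < (n \<bullet> (x - p)) * (n \<bullet> (y - p))"
proof (rule ccontr)
  assume "\<not> ?thesis"
  then have "n \<bullet> x \<le> n \<bullet> p \<and> n \<bullet> p \<le> n \<bullet> y \<or> n \<bullet> y \<le> n \<bullet> p \<and> n \<bullet> p \<le> n \<bullet> x"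
    by (auto simp: inner_diff_right not_less mult_le_0_iff)
  then obtain z where "z \<in> C" "n \<bullet> z = n \<bullet> p"
    using connected_ivt_hyperplane[OF \<open>connected C\<close>] assms(2,3) by metis
  then show False
    using nz[of z] by (simp add: inner_diff_right)
qed

lemma connected_crosses_level:
  fixes C :: "'a::real_inner set"
  assumes "connected C" "q \<in> C" "p \<in> closure C" and \<eta>: "0 < \<eta>" "\<eta> < n \<bullet> (q - p)"
  obtains c where "c \<in> C" "n \<bullet> (c - p) = \<eta>"
proof -
  have "open {x. n \<bullet> x < n \<bullet> p + \<eta>}"
    by (rule open_halfspace_lt)
  moreover have "p \<in> {x. n \<bullet> x < n \<bullet> p + \<eta>}"
    using \<eta> by simp
  ultimately obtain x where "x \<in> C" "n \<bullet> x < n \<bullet> p + \<eta>"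
    using \<open>p \<in> closure C\<close> open_Int_closure_eq_empty[of "{x. n \<bullet> x < n \<bullet> p + \<eta>}" C] by blast
  moreover have "n \<bullet> p + \<eta> \<le> n \<bullet> q"
    using \<eta> by (simp add: inner_diff_right)
  ultimately obtain c where "c \<in> C" "n \<bullet> c = n \<bullet> p + \<eta>"
    using connected_ivt_hyperplane[OF \<open>connected C\<close>] \<open>q \<in> C\<close> by (metis less_imp_le)
  then show thesis
    using that by (simp add: inner_diff_right)
qed


section \<open>An empty double sector at every point\<close>

text \<open>
  In the coordinates \<open>x = a \<bullet> v\<close> and \<open>y = b \<bullet> v\<close> this is, for \<open>s < t\<close>, the open double
  sector \<open>s < x / y < t\<close>. Slopes are measured against the \<open>y\<close>-axis, so that the directions in a cone
  around that axis form an interval of slopes centred at \<open>0\<close>. The product form treats both halves of the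
  sector alike.
\<close>

definition sector :: "'a::real_inner \<Rightarrow> 'a \<Rightarrow> real \<Rightarrow> real \<Rightarrow> 'a set" where
  "sector a b s t = {v. ((a - s *\<^sub>R b) \<bullet> v) * ((a - t *\<^sub>R b) \<bullet> v) < 0}"

lemma sectors_disjoint:
  assumes "s < t" "t \<le> s'" "s' < t'" and v: "v \<in> sector a b s t"
  shows "v \<notin> sector a b s' t'"
proof
  assume v': "v \<in> sector a b s' t'"
  define x y where "x = a \<bullet> v" and "y = b \<bullet> v"
  have 1: "(x - s * y) * (x - t * y) < 0" and 2: "(x - s' * y) * (x - t' * y) < 0"
    using v v' by (simp_all add: sector_def x_def y_def inner_diff_left)
  show False
  proof (cases "y \<ge> 0")
    case True
    then have "s * y \<le> t * y" "t * y \<le> s' * y" "s' * y \<le> t' * y"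
      using assms by (auto intro: mult_right_mono)
    then show False
      using 1 2 by (auto simp: mult_less_0_iff)
  next
    case False
    then have "s * y \<ge> t * y" "t * y \<ge> s' * y" "s' * y \<ge> t' * y"
      using assms by (auto intro: mult_right_mono_neg)
    then show False
      using 1 2 by (auto simp: mult_less_0_iff)
  qed
qed

lemma sector_off_line:
  assumes "m \<le> s" "s < t" and v: "v \<in> sector a b s t"
  shows "(a - m *\<^sub>R b) \<bullet> v \<noteq> 0"
proof
  assume "(a - m *\<^sub>R b) \<bullet> v = 0"
  then have "a \<bullet> v = m * (b \<bullet> v)"
    by (simp add: inner_diff_left)
  then have "((m - s) * (m - t)) * (b \<bullet> v)\<^sup>2 < 0"
    using v by (simp add: sector_def inner_diff_left power2_eq_square algebra_simps)
  moreover have "0 \<le> ((m - s) * (m - t)) * (b \<bullet> v)\<^sup>2"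
    using assms by (intro mult_nonneg_nonneg mult_nonpos_nonpos) auto
  ultimately show False
    by linarith
qed

text \<open>
  The level sets of \<open>a - m 0 *\<^sub>R b\<close> are the parallels to the first of the chosen lines. Only these are
  swept across the pieces of the curve, whereas the other lines serve as walls between the sectors;
  hence the uniform bound on the former and mere finiteness on the latter.
\<close>

lemma empty_sector_at_point:
  fixes \<gamma> :: "real \<Rightarrow> 'a::euclidean_space" and m :: "nat \<Rightarrow> real"
  assumes \<gamma>: "path \<gamma>" and p: "p \<in> path_image \<gamma>" and m: "strict_mono m"
    and fin: "\<And>i. i \<le> Suc (2 * k) \<Longrightarrow> finite {q \<in> path_image \<gamma>. (a - m i *\<^sub>R b) \<bullet> (q - p) = 0}"
    and card0: "\<And>\<eta>. finite {q \<in> path_image \<gamma>. (a - m 0 *\<^sub>R b) \<bullet> (q - p) = \<eta>} \<and>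
                    card {q \<in> path_image \<gamma>. (a - m 0 *\<^sub>R b) \<bullet> (q - p) = \<eta>} \<le> k"
  shows "\<exists>i. \<exists>r>0. \<forall>q\<in>path_image \<gamma>. dist q p < r \<longrightarrow> q - p \<notin> sector a b (m i) (m (Suc i))"
proof (rule ccontr)
  assume "\<not> ?thesis"
  then have acc: "\<exists>q\<in>path_image \<gamma>. dist q p < r \<and> q - p \<in> sector a b (m i) (m (Suc i))"
    if "r > 0" for i r
    using that by blast
  define h where "h i = a - m i *\<^sub>R b" for i
  define F where "F = h ` {..Suc (2 * k)}"
  have F: "finite F" "F \<noteq> {}"
    by (auto simp: F_def)
  have "finite {q \<in> path_image \<gamma>. n \<bullet> (q - p) = 0}" if "n \<in> F" for n
    using that fin by (auto simp: F_def h_def)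
  from path_image_branch_off_lines[OF \<gamma> p F this] obtain r where "r > 0" and r:
    "\<And>q. q \<in> path_image \<gamma> \<Longrightarrow> dist q p < r \<Longrightarrow> q \<noteq> p \<Longrightarrow>
       \<exists>C. connected C \<and> q \<in> C \<and> C \<subseteq> path_image \<gamma> \<and> p \<in> closure C \<and>
           (\<forall>n\<in>F. \<forall>c\<in>C. n \<bullet> (c - p) \<noteq> 0)"
    by blast
  obtain q where q: "\<And>i. q i \<in> path_image \<gamma>" "\<And>i. dist (q i) p < r"
    and q_sector: "\<And>i. q i - p \<in> sector a b (m i) (m (Suc i))"
    using acc[OF \<open>r > 0\<close>] by metis
  have "q i \<noteq> p" for i
    using q_sector[of i] by (auto simp: sector_def)
  then have "\<exists>C. connected C \<and> q i \<in> C \<and> C \<subseteq> path_image \<gamma> \<and> p \<in> closure C \<and>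
           (\<forall>n\<in>F. \<forall>c\<in>C. n \<bullet> (c - p) \<noteq> 0)" for i
    using r q by blast
  then obtain C where C: "\<And>i. connected (C i)" "\<And>i. q i \<in> C i" "\<And>i. C i \<subseteq> path_image \<gamma>"
      "\<And>i. p \<in> closure (C i)"
    and C_off: "\<And>i n c. n \<in> F \<Longrightarrow> c \<in> C i \<Longrightarrow> n \<bullet> (c - p) \<noteq> 0"
    by metis
  have same: "0 < (h j \<bullet> (c - p)) * (h j \<bullet> (q i - p))" if "c \<in> C i" "j \<le> Suc (2 * k)" for c i j
    using that C C_off by (intro connected_inner_same_sign[where C = "C i"]) (auto simp: F_def)
  \<comment> \<open>A piece crosses no wall, so it stays in the sector in which it ends.\<close>
  have C_sector: "c - p \<in> sector a b (m i) (m (Suc i))" if "c \<in> C i" "i \<le> 2 * k" for c i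
    using same[of c i i] same[of c i "Suc i"] q_sector[of i] that
    by (auto simp: sector_def zero_less_mult_iff mult_less_0_iff simp flip: h_def)
  have h0: "h 0 \<bullet> (q i - p) \<noteq> 0" for i
    unfolding h_def using m q_sector[of i]
    by (intro sector_off_line[of _ "m i" "m (Suc i)"]) (auto simp: strict_mono_less strict_mono_less_eq)
  \<comment> \<open>The line of index 0 has at least half of the \<open>2 * k + 1\<close> pieces on one side.\<close>
  obtain \<sigma> :: real and J where \<sigma>: "\<sigma> = 1 \<or> \<sigma> = -1" and J: "J \<subseteq> {..2 * k}" "k < card J"
    and pos: "\<And>i. i \<in> J \<Longrightarrow> 0 < \<sigma> * (h 0 \<bullet> (q i - p))"
  proof -
    define A where "A = {i \<in> {..2 * k}. h 0 \<bullet> (q i - p) > 0}"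
    define B where "B = {i \<in> {..2 * k}. h 0 \<bullet> (q i - p) < 0}"
    have "A \<union> B = {..2 * k}"
      using h0 by (auto simp: A_def B_def neq_iff)
    then have "2 * k + 1 \<le> card A + card B"
      using card_Un_le[of A B] by simp
    then have "k < card A \<or> k < card B"
      by linarith
    then show thesis
    proof
      assume "k < card A"
      then show thesis by (intro that[of 1 A]) (auto simp: A_def)
    next
      assume "k < card B"
      then show thesis by (intro that[of "-1" B]) (auto simp: B_def)
    qed
  qed
  have "finite J" "J \<noteq> {}"
    using J finite_subset by auto
  \<comment> \<open>A shift small enough for the line to separate \<open>p\<close> from all the endpoints \<open>q i\<close> with \<open>i \<in> J\<close>.\<close>
  define \<eta> where "\<eta> = Min ((\<lambda>i. \<sigma> * (h 0 \<bullet> (q i - p))) ` J) / 2"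
  have Min_pos: "0 < Min ((\<lambda>i. \<sigma> * (h 0 \<bullet> (q i - p))) ` J)"
    using \<open>finite J\<close> \<open>J \<noteq> {}\<close> pos by (subst Min_gr_iff) auto
  then have \<eta>: "0 < \<eta>"
    by (simp add: \<eta>_def)
  have "\<eta> < \<sigma> * (h 0 \<bullet> (q i - p))" if "i \<in> J" for i
  proof -
    have "Min ((\<lambda>i. \<sigma> * (h 0 \<bullet> (q i - p))) ` J) \<le> \<sigma> * (h 0 \<bullet> (q i - p))"
      using \<open>finite J\<close> that by (intro Min_le) auto
    then show ?thesis
      using Min_pos by (simp add: \<eta>_def)
  qed
  then have "\<exists>c \<in> C i. (\<sigma> *\<^sub>R h 0) \<bullet> (c - p) = \<eta>" if "i \<in> J" for i
    using connected_crosses_level[of "C i" "q i" p \<eta> "\<sigma> *\<^sub>R h 0"] C \<eta> that by auto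
  then obtain c where cC: "\<And>i. i \<in> J \<Longrightarrow> c i \<in> C i"
    and c_level: "\<And>i. i \<in> J \<Longrightarrow> \<sigma> * (h 0 \<bullet> (c i - p)) = \<eta>"
    by (metis inner_scaleR_left)
  have "inj_on c J"
  proof (rule linorder_inj_onI')
    fix i j assume ij: "i \<in> J" "j \<in> J" "i < j"
    have "c i - p \<notin> sector a b (m j) (m (Suc j))"
      using ij m J cC by (intro sectors_disjoint[of "m i" "m (Suc i)"] C_sector)
        (auto simp: strict_mono_less strict_mono_less_eq)
    moreover have "c j - p \<in> sector a b (m j) (m (Suc j))"
      using ij J cC by (intro C_sector) auto
    ultimately show "c i \<noteq> c j" by auto
  qed
  define Q where "Q = {q \<in> path_image \<gamma>. (a - m 0 *\<^sub>R b) \<bullet> (q - p) = \<sigma> * \<eta>}"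
  have "h 0 \<bullet> (c i - p) = \<sigma> * \<eta>" if "i \<in> J" for i
    using c_level[OF that] \<sigma> by auto
  then have "c ` J \<subseteq> Q"
    using cC C by (force simp: Q_def h_def)
  then have "card J \<le> card Q"
    using card0[of "\<sigma> * \<eta>"] \<open>inj_on c J\<close> by (intro card_inj_on_le) (auto simp: Q_def)
  also have "\<dots> \<le> k"
    using card0[of "\<sigma> * \<eta>"] by (simp add: Q_def)
  finally show False
    using J by simp
qed


section \<open>Countable decomposition into Lipschitz graphs\<close>

text \<open>
  Sorting the points by the index \<open>i\<close>, by a radius \<open>1 / (n + 1)\<close> that works, and by a ball of half that
  radius with centre in a countable dense set makes the local condition hold between any two points of
  the same class.
\<close>

lemma countable_decomposition_avoiding:
  fixes K :: "'a::euclidean_space set" and S :: "nat \<Rightarrow> 'a set"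
  assumes "\<And>p. p \<in> K \<Longrightarrow> \<exists>i. \<exists>r>0. \<forall>q\<in>K. dist q p < r \<longrightarrow> q - p \<notin> S i"
  obtains E :: "nat \<Rightarrow> 'a set" where "K = (\<Union>n. E n)" "\<And>n. bounded (E n)"
    "\<And>n. \<exists>i. \<forall>p\<in>E n. \<forall>q\<in>E n. q - p \<notin> S i"
proof -
  obtain D :: "'a set" where D: "countable D" "\<And>X. open X \<Longrightarrow> X \<noteq> {} \<Longrightarrow> \<exists>d\<in>D. d \<in> X"
    using countable_dense_exists by metis
  have "D \<noteq> {}"
    using D(2)[of UNIV] by auto
  define G where "G i n z = {p \<in> K \<inter> ball z (inverse (Suc n) / 2).
      \<forall>q\<in>K. dist q p < inverse (Suc n) \<longrightarrow> q - p \<notin> S i}" for i n :: nat and z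
  define E where "E l = (case from_nat l of (i :: nat, n :: nat, j :: nat) \<Rightarrow> G i n (from_nat_into D j))" for l
  have E_to_nat: "E (to_nat (i, n, j)) = G i n (from_nat_into D j)" for i n j
    by (simp add: E_def)
  have "\<exists>l. p \<in> E l" if "p \<in> K" for p
  proof -
    obtain i r where "r > 0" and r: "\<And>q. q \<in> K \<Longrightarrow> dist q p < r \<Longrightarrow> q - p \<notin> S i"
      using assms[OF \<open>p \<in> K\<close>] by blast
    obtain n where n: "inverse (Suc n) < r"
      using reals_Archimedean[OF \<open>r > 0\<close>] by auto
    obtain z where "z \<in> D" and z: "z \<in> ball p (inverse (Suc n) / 2)"
      using D(2)[of "ball p (inverse (Suc n) / 2)"] by auto
    obtain j where j: "from_nat_into D j = z"
      using from_nat_into_surj[OF \<open>countable D\<close> \<open>z \<in> D\<close>] by blast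
    have "p \<in> G i n z"
      using \<open>p \<in> K\<close> z r n by (auto simp: G_def dist_commute)
    then show ?thesis
      using E_to_nat[of i n j] j by auto
  qed
  moreover have "E l \<subseteq> K" for l
    by (auto simp: E_def G_def split: prod.splits)
  ultimately have "K = (\<Union>n. E n)"
    by blast
  moreover have "bounded (E l)" for l
  proof -
    have "bounded (G i n z)" for i n z
      by (rule bounded_subset[OF bounded_ball[of z "inverse (Suc n) / 2"]]) (auto simp: G_def)
    then show ?thesis
      by (auto simp: E_def split: prod.splits)
  qed
  moreover have "\<exists>i. \<forall>p\<in>E l. \<forall>q\<in>E l. q - p \<notin> S i" for l
  proof -
    have "q - p \<notin> S i" if "p \<in> G i n z" "q \<in> G i n z" for i n z p q
    proof -
      have "dist q p < inverse (Suc n)"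
        using that dist_triangle_half_r[of z q "inverse (Suc n)" p] by (auto simp: G_def)
      then show ?thesis
        using that by (auto simp: G_def)
    qed
    moreover obtain i n j where "from_nat l = (i :: nat, n :: nat, j :: nat)"
      by (metis prod_cases3)
    ultimately show ?thesis
      by (intro exI[of _ i]) (auto simp: E_def)
  qed
  ultimately show thesis
    using that by blast
qed

text \<open>
  With \<open>u\<close> the middle slope, \<open>w = x - u * y\<close> vanishes on the middle line of the sector. Outside the
  sector \<open>\<bar>y\<bar>\<close> is at most a constant times \<open>\<bar>w\<bar>\<close>, so \<open>w\<close> is large whenever \<open>v\<close> is.
\<close>

lemma norm_le_off_sector:
  fixes a b v :: "'a::real_inner"
  assumes "s < t" and v: "v \<notin> sector a b s t" and ab: "norm v \<le> \<bar>a \<bullet> v\<bar> + \<bar>b \<bullet> v\<bar>"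
  defines "u \<equiv> (s + t) / 2"
  shows "norm v \<le> (1 + (\<bar>u\<bar> + 1) * (2 / (t - s))) * \<bar>(a - u *\<^sub>R b) \<bullet> v\<bar>"
proof -
  define y w where "y = b \<bullet> v" and "w = (a - u *\<^sub>R b) \<bullet> v"
  define \<delta> where "\<delta> = (t - s) / 2"
  have "\<delta> > 0"
    using \<open>s < t\<close> by (simp add: \<delta>_def)
  have x: "a \<bullet> v = w + u * y"
    by (simp add: w_def y_def inner_diff_left)
  \<comment> \<open>The two factors defining the sector are \<open>w \<plusminus> \<delta> * y\<close>.\<close>
  have "(a - s *\<^sub>R b) \<bullet> v = w + \<delta> * y" "(a - t *\<^sub>R b) \<bullet> v = w - \<delta> * y"
    by (simp_all add: inner_diff_left x flip: y_def) (simp_all add: u_def \<delta>_def field_simps)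
  then have "0 \<le> (w + \<delta> * y) * (w - \<delta> * y)"
    using v by (simp add: sector_def)
  then have "(\<delta> * y)\<^sup>2 \<le> w\<^sup>2"
    by (simp add: power2_eq_square algebra_simps)
  then have "\<delta> * \<bar>y\<bar> \<le> \<bar>w\<bar>"
    using \<open>\<delta> > 0\<close> by (simp add: abs_le_square_iff[symmetric] abs_mult)
  then have y: "\<bar>y\<bar> \<le> 2 / (t - s) * \<bar>w\<bar>"
    using \<open>s < t\<close> by (simp add: \<delta>_def field_simps)
  have "norm v \<le> \<bar>w + u * y\<bar> + \<bar>y\<bar>"
    using ab by (simp add: x flip: y_def)
  also have "\<dots> \<le> \<bar>w\<bar> + (\<bar>u\<bar> + 1) * \<bar>y\<bar>"
    using abs_triangle_ineq[of w "u * y"] by (simp add: abs_mult algebra_simps)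
  also have "\<dots> \<le> \<bar>w\<bar> + (\<bar>u\<bar> + 1) * (2 / (t - s) * \<bar>w\<bar>)"
    using y by (intro add_left_mono mult_left_mono) auto
  finally show ?thesis
    by (simp add: w_def algebra_simps)
qed

text \<open>McShane's formula: the extension is the largest \<open>L\<close>-Lipschitz function below \<open>f\<close> on \<open>A\<close>.\<close>

lemma lipschitz_extension_real:
  fixes f :: "'a::metric_space \<Rightarrow> real"
  assumes f: "L-lipschitz_on A f"
  obtains g where "L-lipschitz_on UNIV g" "\<And>x. x \<in> A \<Longrightarrow> g x = f x"
proof (cases "A = {}")
  case True
  have "L-lipschitz_on UNIV (\<lambda>_. 0 :: real)"
    using lipschitz_on_nonneg[OF f] by (simp add: lipschitz_on_def)
  then show thesis
    using that True by blast
next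
  case False
  define g where "g x = (INF s\<in>A. f s + L * dist x s)" for x
  have L: "0 \<le> L"
    using f by (rule lipschitz_on_nonneg)
  have lip: "f x \<le> f y + L * dist x y" if "x \<in> A" "y \<in> A" for x y
    using lipschitz_onD[OF f that] by (simp add: dist_real_def)
  have tri: "f s + L * dist x s \<le> f s + L * dist y s + L * dist x y" for x y s
    using mult_left_mono[OF dist_triangle[of x s y] L] by (simp add: algebra_simps)
  obtain s0 where s0: "s0 \<in> A"
    using False by blast
  have bdd: "bdd_below ((\<lambda>s. f s + L * dist x s) ` A)" for x
  proof (rule bdd_belowI2)
    fix s assume "s \<in> A"
    then show "f s0 - L * dist s0 x \<le> f s + L * dist x s"
      using lip[OF s0 \<open>s \<in> A\<close>] mult_left_mono[OF dist_triangle[of s0 s x] L]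
      by (simp add: algebra_simps)
  qed
  have le: "g x \<le> g y + L * dist x y" for x y
  proof -
    have "g x - L * dist x y \<le> g y"
      unfolding g_def[of y]
    proof (rule cINF_greatest[OF False])
      fix s assume "s \<in> A"
      then have "g x \<le> f s + L * dist x s"
        unfolding g_def by (intro cINF_lower bdd)
      then show "g x - L * dist x y \<le> f s + L * dist y s"
        using tri[of s x y] by linarith
    qed
    then show ?thesis by simp
  qed
  show thesis
  proof (rule that)
    show "L-lipschitz_on UNIV g"
    proof (rule lipschitz_onI[OF _ L])
      show "dist (g x) (g y) \<le> L * dist x y" for x y
        using le[of x y] le[of y x] by (simp add: dist_real_def abs_le_iff dist_commute)
    qed
    fix x assume "x \<in> A"
    then have "g x \<le> f x + L * dist x x"
      unfolding g_def by (intro cINF_lower bdd)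
    moreover have "f x \<le> g x"
      unfolding g_def using False lip[OF \<open>x \<in> A\<close>] by (intro cINF_greatest) auto
    ultimately show "g x = f x" by simp
  qed
qed

lemma lipschitz_extension_euclidean:
  fixes f :: "'a::metric_space \<Rightarrow> 'b::euclidean_space"
  assumes f: "L-lipschitz_on A f"
  obtains M g where "M-lipschitz_on UNIV g" "\<And>x. x \<in> A \<Longrightarrow> g x = f x"
proof -
  have "\<exists>g. L-lipschitz_on UNIV g \<and> (\<forall>x\<in>A. g x = f x \<bullet> i)" if "i \<in> Basis" for i
  proof -
    have lip: "L-lipschitz_on A (\<lambda>x. f x \<bullet> i)"
    proof (rule lipschitz_onI)
      fix x y assume "x \<in> A" "y \<in> A"
      have "dist (f x \<bullet> i) (f y \<bullet> i) \<le> dist (f x) (f y)"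
        using Basis_le_norm[OF that, of "f x - f y"] by (simp add: dist_norm inner_diff_left)
      also have "\<dots> \<le> L * dist x y"
        using lipschitz_onD[OF f] \<open>x \<in> A\<close> \<open>y \<in> A\<close> by blast
      finally show "dist (f x \<bullet> i) (f y \<bullet> i) \<le> L * dist x y" .
    qed (rule lipschitz_on_nonneg[OF f])
    show ?thesis
    proof (rule lipschitz_extension_real[OF lip])
      fix g assume "L-lipschitz_on UNIV g" "\<And>x. x \<in> A \<Longrightarrow> g x = f x \<bullet> i"
      then show ?thesis
        by (intro exI[of _ g]) simp
    qed
  qed
  then have "\<exists>G. \<forall>i\<in>Basis. L-lipschitz_on UNIV (G i) \<and> (\<forall>x\<in>A. G i x = f x \<bullet> i)"
    by (intro bchoice) blast
  then obtain G where G: "\<And>i. i \<in> Basis \<Longrightarrow> L-lipschitz_on UNIV (G i)"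
    and G_eq: "\<And>i x. i \<in> Basis \<Longrightarrow> x \<in> A \<Longrightarrow> G i x = f x \<bullet> i"
    by blast
  define g where "g x = (\<Sum>i\<in>Basis. G i x *\<^sub>R i)" for x
  show thesis
  proof (rule that)
    show "(DIM('b) * L)-lipschitz_on UNIV g"
    proof (rule lipschitz_onI)
      fix x y
      have "dist (g x) (g y) \<le> (\<Sum>i\<in>Basis. \<bar>(g x - g y) \<bullet> i\<bar>)"
        by (simp add: dist_norm norm_le_l1)
      also have "\<dots> = (\<Sum>i\<in>Basis. dist (G i x) (G i y))"
        by (intro sum.cong) (simp_all add: g_def dist_real_def inner_diff_left)
      also have "\<dots> \<le> (\<Sum>i\<in>(Basis :: 'b set). L * dist x y)"
        using G by (intro sum_mono) (auto dest: lipschitz_onD)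
      finally show "dist (g x) (g y) \<le> DIM('b) * L * dist x y"
        by simp
    qed (use lipschitz_on_nonneg[OF f] in simp)
    fix x assume "x \<in> A"
    then show "g x = f x"
      by (simp add: g_def G_eq euclidean_representation)
  qed
qed

text \<open>
  On \<open>E\<close> the functional \<open>n\<close> is injective with Lipschitz inverse; extending this inverse to the whole
  line gives the curve.
\<close>

lemma lipschitz_curve_through:
  fixes E :: "'a::euclidean_space set"
  assumes "bounded E" and E: "\<And>v w. v \<in> E \<Longrightarrow> w \<in> E \<Longrightarrow> norm (v - w) \<le> L * \<bar>n \<bullet> (v - w)\<bar>" and "0 \<le> L"
  obtains M g B where "M-lipschitz_on UNIV g" "E \<subseteq> g ` {-B..<B :: real}"
proof -
  have inj: "inj_on (\<lambda>v. n \<bullet> v) E"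
  proof (rule inj_onI)
    fix v w assume "v \<in> E" "w \<in> E" "n \<bullet> v = n \<bullet> w"
    then show "v = w"
      using E[of v w] by (simp add: inner_diff_right)
  qed
  define f where "f = inv_into E (\<lambda>v. n \<bullet> v)"
  have f: "f (n \<bullet> v) = v" if "v \<in> E" for v
    unfolding f_def using inj that by simp
  have "L-lipschitz_on ((\<lambda>v. n \<bullet> v) ` E) f"
    using E \<open>0 \<le> L\<close> by (auto intro!: lipschitz_onI simp: f dist_norm inner_diff_right)
  then obtain M g where g: "M-lipschitz_on UNIV g" "\<And>x. x \<in> (\<lambda>v. n \<bullet> v) ` E \<Longrightarrow> g x = f x"
    using lipschitz_extension_euclidean by metis
  obtain R where R: "\<And>v. v \<in> E \<Longrightarrow> norm v \<le> R"
    using \<open>bounded E\<close> by (auto simp: bounded_iff)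
  have "n \<bullet> v \<in> {-(norm n * R + 1)..<norm n * R + 1}" if "v \<in> E" for v
  proof -
    have "\<bar>n \<bullet> v\<bar> \<le> norm n * norm v"
      by (rule Cauchy_Schwarz_ineq2)
    also have "\<dots> \<le> norm n * R"
      using R[OF that] by (intro mult_left_mono) auto
    finally show ?thesis by auto
  qed
  then have "E \<subseteq> g ` {-(norm n * R + 1)..<norm n * R + 1}"
    using g(2) f by force
  then show thesis
    using that g(1) by blast
qed


section \<open>Hausdorff measure of Lipschitz curves\<close>

text \<open>Cutting the parameter interval into \<open>N\<close> equal parts covers \<open>E\<close> by \<open>N\<close> sets of diameter at most
  \<open>2 * B * L / N\<close>, whose total is independent of \<open>N\<close>.\<close>

lemma hausdorff1_le_lipschitz:
  fixes g :: "real \<Rightarrow> 'a::real_normed_vector"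
  assumes g: "L-lipschitz_on UNIV g" and E: "E \<subseteq> g ` {-B..<B}" and "0 < B"
  shows "hausdorff1 E \<le> ennreal (2 * B * L)"
  unfolding hausdorff1_def
proof (rule SUP_least)
  fix \<delta> :: real assume "\<delta> \<in> {0<..}"
  then have "0 < \<delta>" by simp
  have L: "0 \<le> L"
    using g by (rule lipschitz_on_nonneg)
  obtain N where N: "2 * B * L / \<delta> < real N"
    using reals_Archimedean2 by blast
  then have "0 < real N"
    using \<open>0 < B\<close> L \<open>0 < \<delta>\<close> by (intro le_less_trans[OF _ N]) auto
  define w where "w = 2 * B / N"
  have "0 < w" and Nw: "N * w = 2 * B"
    using \<open>0 < B\<close> \<open>0 < real N\<close> by (simp_all add: w_def)
  have "L * w \<le> \<delta>"
    using N \<open>0 < \<delta>\<close> \<open>0 < real N\<close> by (simp add: w_def field_simps)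
  define U where "U i = (if i < N then g ` {-B + i * w .. -B + (i + 1) * w} else {})" for i :: nat
  have diam: "diameter (U i) \<le> L * w" for i
  proof (cases "i < N")
    case True
    show ?thesis
    proof (rule diameter_le)
      fix x y assume "x \<in> U i" "y \<in> U i"
      then obtain s t where st: "s \<in> {-B + i * w .. -B + (i + 1) * w}" "t \<in> {-B + i * w .. -B + (i + 1) * w}"
        "x = g s" "y = g t"
        using True by (auto simp: U_def)
      have "norm (x - y) \<le> L * dist s t"
        using lipschitz_onD[OF g, of s t] st by (simp add: dist_norm)
      also have "\<dots> \<le> L * w"
        using st L by (intro mult_left_mono) (auto simp: dist_real_def algebra_simps)
      finally show "norm (x - y) \<le> L * w" .
    qed (use L \<open>0 < w\<close> in simp)
  next
    case False
    then show ?thesis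
      using L \<open>0 < w\<close> by (simp add: U_def)
  qed
  have "bounded (U i)" for i
  proof -
    have "continuous_on UNIV g"
      using g by (rule lipschitz_on_continuous_on)
    then have "compact (g ` {-B + i * w .. -B + (i + 1) * w})"
      by (intro compact_continuous_image) (auto intro: continuous_on_subset)
    then show ?thesis
      by (simp add: U_def compact_imp_bounded)
  qed
  moreover have "E \<subseteq> (\<Union>i. U i)"
  proof
    fix x assume "x \<in> E"
    from subsetD[OF E this] obtain t where t: "-B \<le> t" "t < B" "x = g t"
      by auto
    define i where "i = nat \<lfloor>(t + B) / w\<rfloor>"
    have "0 \<le> (t + B) / w"
      using t \<open>0 < w\<close> by simp
    then have i: "real i \<le> (t + B) / w" "(t + B) / w < real i + 1"
      unfolding i_def by linarith+
    have "i * w \<le> t + B" "t + B < (i + 1) * w"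
      using i \<open>0 < w\<close> by (simp_all add: field_simps)
    moreover have "i < N"
    proof -
      have "i * w < N * w"
        using \<open>i * w \<le> t + B\<close> t Nw by simp
      then show ?thesis
        using \<open>0 < w\<close> by simp
    qed
    ultimately have "x \<in> U i"
      using t by (auto simp: U_def)
    then show "x \<in> (\<Union>i. U i)"
      by blast
  qed
  ultimately have "hausdorff1_pre \<delta> E \<le> (\<Sum>i. ennreal (diameter (U i)))"
    unfolding hausdorff1_pre_def using diam \<open>L * w \<le> \<delta>\<close> by (intro INF_lower) (auto intro: order_trans)
  also have "\<dots> = (\<Sum>i<N. ennreal (diameter (U i)))"
    by (rule suminf_finite) (auto simp: U_def)
  also have "\<dots> \<le> (\<Sum>i<N. ennreal (L * w))"
    using diam by (intro sum_mono ennreal_leI) auto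
  also have "\<dots> = ennreal (N * (L * w))"
    using L \<open>0 < w\<close> by (simp add: ennreal_mult ennreal_of_nat_eq_real_of_nat)
  also have "N * (L * w) = 2 * B * L"
    using Nw by (simp add: algebra_simps)
  finally show "hausdorff1_pre \<delta> E \<le> ennreal (2 * B * L)" .
qed

lemma hausdorff1_empty: "hausdorff1 ({} :: 'a::metric_space set) = 0"
proof -
  have "hausdorff1_pre \<delta> ({} :: 'a set) \<le> (\<Sum>i::nat. ennreal (diameter ({} :: 'a set)))" if "\<delta> > 0" for \<delta>
    unfolding hausdorff1_pre_def using that by (intro INF_lower) simp
  then have "hausdorff1 ({} :: 'a set) \<le> 0"
    unfolding hausdorff1_def by (intro SUP_least) simp
  then show ?thesis
    by simp
qed


section \<open>Lines in the rotated cone\<close>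

lemma inner_rotated_axes:
  "rotate2 \<rho> (vector [1, 0]) \<bullet> v = cos \<rho> * v$1 + sin \<rho> * v$2"
  "rotate2 \<rho> (vector [0, 1]) \<bullet> v = cos \<rho> * v$2 - sin \<rho> * v$1"
  by (simp_all add: rotate2_def inner_vec_def sum_2)

lemma rotate2_coordinates:
  "rotate2 \<rho> (vector [rotate2 \<rho> (vector [1, 0]) \<bullet> v, rotate2 \<rho> (vector [0, 1]) \<bullet> v]) = v"
proof -
  have "cos \<rho> * (cos \<rho> * x + sin \<rho> * y) - sin \<rho> * (cos \<rho> * y - sin \<rho> * x) = ((cos \<rho>)\<^sup>2 + (sin \<rho>)\<^sup>2) * x"
    "sin \<rho> * (cos \<rho> * x + sin \<rho> * y) + cos \<rho> * (cos \<rho> * y - sin \<rho> * x) = ((cos \<rho>)\<^sup>2 + (sin \<rho>)\<^sup>2) * y" for x y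
    by algebra+
  then show ?thesis
    unfolding inner_rotated_axes by (simp add: rotate2_def vec_eq_iff forall_2)
qed

lemma norm_rotate2: "norm (rotate2 \<rho> v) = norm v"
proof -
  have "(cos \<rho> * x - sin \<rho> * y)\<^sup>2 + (sin \<rho> * x + cos \<rho> * y)\<^sup>2 = ((cos \<rho>)\<^sup>2 + (sin \<rho>)\<^sup>2) * (x\<^sup>2 + y\<^sup>2)" for x y
    by algebra
  then show ?thesis
    by (simp add: norm_vec_def L2_set_def sum_2 rotate2_def)
qed

lemma norm_le_rotated_coordinates:
  "norm v \<le> \<bar>rotate2 \<rho> (vector [1, 0]) \<bullet> v\<bar> + \<bar>rotate2 \<rho> (vector [0, 1]) \<bullet> v\<bar>"
proof -
  have "norm v = norm (vector [rotate2 \<rho> (vector [1, 0]) \<bullet> v, rotate2 \<rho> (vector [0, 1]) \<bullet> v] :: real^2)"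
    by (metis norm_rotate2 rotate2_coordinates)
  then show ?thesis
    using norm_le_l1_cart[of "vector [rotate2 \<rho> (vector [1, 0]) \<bullet> v, rotate2 \<rho> (vector [0, 1]) \<bullet> v] :: real^2"]
    by (simp add: sum_2)
qed

text \<open>
  In the rotated coordinates the line is \<open>x - m * y = const\<close>, with direction \<open>(m, 1)\<close>. This direction
  lies in the cone exactly when \<open>\<bar>m\<bar> * tan \<phi> \<le> 1\<close>, and any point of the line can serve as the vertex.
\<close>

lemma steep_line_in_cone:
  fixes \<phi> \<rho> m \<eta> :: real and p :: "real^2"
  assumes "\<bar>m\<bar> * tan \<phi> \<le> 1" and "0 \<le> tan \<phi>"
  defines "n \<equiv> rotate2 \<rho> (vector [1, 0]) - m *\<^sub>R rotate2 \<rho> (vector [0, 1])"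
  shows "is_line {v. n \<bullet> (v - p) = \<eta>}"
    and "\<exists>P. {v. n \<bullet> (v - p) = \<eta>} \<subseteq> cone_at P \<phi> \<rho>"
proof -
  define a b :: "real^2" where "a = rotate2 \<rho> (vector [1, 0])" and "b = rotate2 \<rho> (vector [0, 1])"
  have n: "n = a - m *\<^sub>R b"
    by (simp add: n_def a_def b_def)
  have "a \<bullet> a = 1" 
    using norm_rotate2[of \<rho> "vector [1, 0]"] unfolding a_def
    by (simp add: dot_square_norm norm_vec_def L2_set_def sum_2)
  have "b \<bullet> a = 0"
    by (simp add: b_def inner_rotated_axes) (simp add: a_def rotate2_def)
  have na: "n \<bullet> a = 1"
    using \<open>a \<bullet> a = 1\<close> \<open>b \<bullet> a = 0\<close> by (simp add: n inner_diff_left)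
  then have "n \<noteq> 0"
    by auto
  have eq: "{v. n \<bullet> (v - p) = \<eta>} = {v. n \<bullet> v = n \<bullet> p + \<eta>}"
    by (auto simp: inner_diff_right)
  show "is_line {v. n \<bullet> (v - p) = \<eta>}"
    unfolding eq is_line_def using \<open>n \<noteq> 0\<close> by (simp add: affine_hyperplane aff_dim_hyperplane)
  show "\<exists>P. {v. n \<bullet> (v - p) = \<eta>} \<subseteq> cone_at P \<phi> \<rho>"
  proof (intro exI subsetI)
    fix v assume v: "v \<in> {v. n \<bullet> (v - p) = \<eta>}"
    \<comment> \<open>The vertex is the point where the line through \<open>p\<close> along \<open>a\<close> meets the given line.\<close>
    define P where "P = p + \<eta> *\<^sub>R a"
    have "n \<bullet> (v - P) = 0"
      using v na by (simp add: P_def inner_diff_right inner_add_right)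
    then have "a \<bullet> (v - P) = m * (b \<bullet> (v - P))"
      by (simp add: n inner_diff_left)
    then have "tan \<phi> * \<bar>a \<bullet> (v - P)\<bar> = (\<bar>m\<bar> * tan \<phi>) * \<bar>b \<bullet> (v - P)\<bar>"
      by (simp add: abs_mult)
    also have "\<dots> \<le> 1 * \<bar>b \<bullet> (v - P)\<bar>"
      using assms(1) by (intro mult_right_mono) auto
    finally have "vector [a \<bullet> (v - P), b \<bullet> (v - P)] \<in> cone0 \<phi>"
      by (simp add: cone0_def)
    moreover have "rotate2 \<rho> (vector [a \<bullet> (v - P), b \<bullet> (v - P)]) = v - P"
      unfolding a_def b_def by (rule rotate2_coordinates)
    ultimately have "v - P \<in> rotate2 \<rho> ` cone0 \<phi>"
      by (metis imageI)
    then have "P + (v - P) \<in> cone_at P \<phi> \<rho>"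
      unfolding cone_at_def by (rule imageI)
    then show "v \<in> cone_at (p + \<eta> *\<^sub>R a) \<phi> \<rho>"
      by (simp add: P_def)
  qed
qed


section \<open>Curves meeting the lines of a cone in boundedly many points\<close>

theorem theorem4:
  fixes k :: nat and \<phi> \<rho> :: real and \<gamma> :: "real \<Rightarrow> real^2"
  assumes "k \<ge> 2"
    and "0 < \<phi>" and "\<phi> < pi / 2"
    and "0 \<le> \<rho>" and "\<rho> < 2 * pi"
    and "path \<gamma>"
    and "\<And>P l. is_line l \<Longrightarrow> l \<subseteq> cone_at P \<phi> \<rho> \<Longrightarrow>
           finite (l \<inter> path_image \<gamma>) \<and> card (l \<inter> path_image \<gamma>) \<le> k"
  shows "(\<exists>\<Gamma> :: nat \<Rightarrow> (real^2) set.
            path_image \<gamma> = (\<Union>n. \<Gamma> n) \<and> (\<forall>n. hausdorff1 (\<Gamma> n) < \<infinity>))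
         \<and> rectifiable1 (path_image \<gamma>)"
proof -
  define a b :: "real^2" where "a = rotate2 \<rho> (vector [1, 0])" and "b = rotate2 \<rho> (vector [0, 1])"
  have tan: "0 < tan \<phi>"
    using assms(2,3) by (intro tan_gt_zero) auto
  \<comment> \<open>Equally spaced slopes from \<open>- cot \<phi>\<close> at \<open>i = 0\<close> to \<open>cot \<phi>\<close> at \<open>i = 2 * k + 1\<close>.\<close>
  define m where "m i = (2 * (real i / (2 * k + 1)) - 1) / tan \<phi>" for i :: nat
  have m: "strict_mono m"
    using tan by (auto intro!: strict_monoI divide_strict_right_mono simp: m_def)
  have steep: "\<bar>m i\<bar> * tan \<phi> \<le> 1" if "i \<le> Suc (2 * k)" for i
  proof -
    have "real i / (2 * k + 1) \<le> 1"
      using that by (simp add: field_simps)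
    moreover have "0 \<le> real i / (2 * k + 1)"
      by simp
    ultimately have "\<bar>2 * (real i / (2 * k + 1)) - 1\<bar> \<le> 1"
      unfolding abs_le_iff by linarith
    then show ?thesis
      using tan by (simp add: m_def abs_divide)
  qed
  have lines: "finite {q \<in> path_image \<gamma>. (a - m i *\<^sub>R b) \<bullet> (q - p) = \<eta>} \<and>
               card {q \<in> path_image \<gamma>. (a - m i *\<^sub>R b) \<bullet> (q - p) = \<eta>} \<le> k"
    if i: "i \<le> Suc (2 * k)" for i p \<eta>
  proof -
    obtain P where "{v. (a - m i *\<^sub>R b) \<bullet> (v - p) = \<eta>} \<subseteq> cone_at P \<phi> \<rho>"
      using steep_line_in_cone(2)[OF steep[OF i], of \<rho> p \<eta>] tan unfolding a_def b_def by auto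
    moreover have "is_line {v. (a - m i *\<^sub>R b) \<bullet> (v - p) = \<eta>}"
      using steep_line_in_cone(1)[OF steep[OF i], of \<rho> p \<eta>] tan unfolding a_def b_def by auto
    ultimately have "finite ({v. (a - m i *\<^sub>R b) \<bullet> (v - p) = \<eta>} \<inter> path_image \<gamma>) \<and>
        card ({v. (a - m i *\<^sub>R b) \<bullet> (v - p) = \<eta>} \<inter> path_image \<gamma>) \<le> k"
      using assms(7) by blast
    moreover have "{v. (a - m i *\<^sub>R b) \<bullet> (v - p) = \<eta>} \<inter> path_image \<gamma>
        = {q \<in> path_image \<gamma>. (a - m i *\<^sub>R b) \<bullet> (q - p) = \<eta>}"
      by blast
    ultimately show ?thesis by simp
  qed
  have "\<exists>i. \<exists>r>0. \<forall>q\<in>path_image \<gamma>. dist q p < r \<longrightarrow> q - p \<notin> sector a b (m i) (m (Suc i))"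
    if "p \<in> path_image \<gamma>" for p
    using lines by (intro empty_sector_at_point[OF \<open>path \<gamma>\<close> that m]) auto
  then obtain E :: "nat \<Rightarrow> (real^2) set" where E: "path_image \<gamma> = (\<Union>n. E n)"
    and E_bounded: "\<And>n. bounded (E n)"
    and E_sector: "\<And>n. \<exists>i. \<forall>p\<in>E n. \<forall>q\<in>E n. q - p \<notin> sector a b (m i) (m (Suc i))"
    by (rule countable_decomposition_avoiding[where S = "\<lambda>i. sector a b (m i) (m (Suc i))"]) auto
  have "\<exists>M g B. M-lipschitz_on UNIV g \<and> E n \<subseteq> g ` {-B..<B :: real}" for n
  proof -
    obtain i where i: "\<And>p q. p \<in> E n \<Longrightarrow> q \<in> E n \<Longrightarrow> q - p \<notin> sector a b (m i) (m (Suc i))"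
      using E_sector by blast
    have mi: "m i < m (Suc i)"
      using m by (simp add: strict_mono_less)
    define u where "u = (m i + m (Suc i)) / 2"
    define L where "L = 1 + (\<bar>u\<bar> + 1) * (2 / (m (Suc i) - m i))"
    have "0 \<le> L"
      using mi by (simp add: L_def)
    have "norm (v - w) \<le> L * \<bar>(a - u *\<^sub>R b) \<bullet> (v - w)\<bar>" if "v \<in> E n" "w \<in> E n" for v w
      unfolding L_def u_def
      using mi i[OF that(2,1)] norm_le_rotated_coordinates[of "v - w" \<rho>]
      by (intro norm_le_off_sector) (auto simp: a_def b_def)
    then show ?thesis
      using lipschitz_curve_through[OF E_bounded _ \<open>0 \<le> L\<close>] by metis
  qed
  then obtain M g B where g: "\<And>n. (M n)-lipschitz_on UNIV (g n)" and Eg: "\<And>n. E n \<subseteq> g n ` {-(B n)..<B n :: real}"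
    by metis
  have "hausdorff1 (E n) < \<infinity>" for n
  proof -
    have "E n \<subseteq> g n ` {-(max 1 (B n))..<max 1 (B n)}"
      using Eg[of n] by fastforce
    then have "hausdorff1 (E n) \<le> ennreal (2 * max 1 (B n) * M n)"
      by (intro hausdorff1_le_lipschitz[OF g]) auto
    then show ?thesis
      by (simp add: le_less_trans[OF _ ennreal_less_top])
  qed
  moreover have "rectifiable1 (path_image \<gamma>)"
    unfolding rectifiable1_def
  proof (intro exI[of _ g] conjI allI)
    show "\<exists>L. L-lipschitz_on UNIV (g i)" for i
      using g by blast
    have "E n \<subseteq> range (g n)" for n
      by (rule order_trans[OF Eg image_mono]) simp
    then have "path_image \<gamma> \<subseteq> (\<Union>i. range (g i))"
      unfolding E by (intro UN_mono) simp_all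
    then have "path_image \<gamma> - (\<Union>i. range (g i)) = {}"
      by (simp only: Diff_eq_empty_iff)
    then show "hausdorff1 (path_image \<gamma> - (\<Union>i. range (g i))) = 0"
      by (simp only: hausdorff1_empty)
  qed
  ultimately show ?thesis
    using E by (intro conjI exI[of _ E]) simp_all
qed

end
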